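(* For every $p > 2$ there exist Hankel forms $H_\varphi \in S_p(\mathscr{H}^2_0)$ such that no $\psi$ in $L^2(\mathbb{T}^\infty)$ satisfies $H_\varphi = H_\psi$ (as forms on $\mathscr{H}^2_0\times\mathscr{H}^2_0$). In particular, there exist Hankel forms $H_\varphi \in S_p(\mathscr{H}^2_0)$ for which there are no bounded symbols.
   Context: $\mathscr{H}^2$ is the Hilbert space of Dirichlet series $f(s)=\sum_{n\ge1}a_nn^{-s}$ with $\|f\|_{\mathscr{H}^2}=(\sum_{n\ge1}|a_n|^2)^{1/2}<\infty$ and inner product $\langle\cdot,\cdot\rangle$; $\mathscr{H}^2_0$ is its subspace of series with $a_1=f(+\infty)=0$. Hankel forms: for a (formal) Dirichlet series $\varphi(s)=\sum_n\overline{\varrho_n}n^{-s}$, $H_\varphi(fg)=\langle fg,\varphi\rangle=\sum_m\sum_na_mb_n\varrho_{mn}$ for Dirichlet polynomials $f=\sum a_mm^{-s}$, $g=\sum b_nn^{-s}$. Acting on $\mathscr{H}^2_0\times\mathscr{H}^2_0$ it has the matrix $(\varrho_{mn})_{m,n\ge2}$. If this matrix defines a compact operator on $\ell^2$ with singular value sequence $\Lambda$, then $H_\varphi\in S_p(\mathscr{H}^2_0)$, $0<p\le\infty$, means that $\Lambda\in\ell^p$. Bohr lift: if $n=\prod_jp_j^{\kappa_j}$ ($p_j$ the $j$th prime), put $\kappa(n)=(\kappa_1,\kappa_2,\dots)$ and $\mathscr{B}f(z)=\sum_na_nz^{\kappa(n)}$, $z\in\mathbb{T}^\infty$. With $m_\infty$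 the normalized Haar measure on $\mathbb{T}^\infty$, $L^q(\mathbb{T}^\infty)=L^q(\mathbb{T}^\infty,m_\infty)$ and $\psi\in L^2(\mathbb{T}^\infty)$, put $H_\psi(fg)=\int_{\mathbb{T}^\infty}\mathscr{B}f\,\mathscr{B}g\,\overline{\psi}\,dm_\infty$. The equality $H_\varphi=H_\psi$ on $\mathscr{H}^2_0\times\mathscr{H}^2_0$ means that the two forms agree for all Dirichlet polynomials $f,g\in\mathscr{H}^2_0$. A bounded symbol of $H_\varphi$ is a $\psi\in L^\infty(\mathbb{T}^\infty)$ with $H_\varphi=H_\psi$. *)

theory Defs
  imports "HOL-Probability.Probability" "HOL-Computational_Algebra.Primes"
begin

section \<open>The complex sequence space \<open>\<ell>\<^sup>2\<close>\<close>

typedef ell2 = "{x :: nat \<Rightarrow> complex. summable (\<lambda>n. (cmod (x n))\<^sup>2)}"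
  morphisms ell2_nth Abs_ell2
  by (rule exI[of _ "\<lambda>_. 0"]) simp

setup_lifting type_definition_ell2

lemma ell2_nth_summable: "summable (\<lambda>n. (cmod (ell2_nth x n))\<^sup>2)"
  using ell2_nth[of x] by simp

lemma ell2_eqI: "(\<And>n. ell2_nth x n = ell2_nth y n) \<Longrightarrow> x = y"
  by (metis ell2_nth_inject ext)

lemma summable_cmod_add_sq:
  assumes "summable (\<lambda>n. (cmod (x n))\<^sup>2)" "summable (\<lambda>n. (cmod (y n))\<^sup>2)"
  shows "summable (\<lambda>n::nat. (cmod (x n + y n))\<^sup>2)"
proof (rule summable_comparison_test')
  show "summable (\<lambda>n. 2 * (cmod (x n))\<^sup>2 + 2 * (cmod (y n))\<^sup>2)"
    by (intro summable_add summable_mult assms)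
  fix n :: nat
  have "(cmod (x n + y n))\<^sup>2 \<le> (cmod (x n) + cmod (y n))\<^sup>2"
    by (intro power_mono norm_triangle_ineq) auto
  also have "\<dots> \<le> 2 * (cmod (x n))\<^sup>2 + 2 * (cmod (y n))\<^sup>2"
    using zero_le_power2[of "cmod (x n) - cmod (y n)"] by (simp add: power2_sum power2_diff)
  finally show "norm ((cmod (x n + y n))\<^sup>2) \<le> 2 * (cmod (x n))\<^sup>2 + 2 * (cmod (y n))\<^sup>2" by simp
qed

lemma summable_mult_cnj:
  assumes "summable (\<lambda>n. (cmod (x n))\<^sup>2)" "summable (\<lambda>n. (cmod (y n))\<^sup>2)"
  shows "summable (\<lambda>n::nat. x n * cnj (y n))"
proof (rule summable_comparison_test')
  show "summable (\<lambda>n. (cmod (x n))\<^sup>2 + (cmod (y n))\<^sup>2)"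
    by (intro summable_add assms)
  fix n :: nat
  have "2 * (cmod (x n) * cmod (y n)) \<le> (cmod (x n))\<^sup>2 + (cmod (y n))\<^sup>2"
    using zero_le_power2[of "cmod (x n) - cmod (y n)"] by (simp add: power2_diff)
  moreover have "0 \<le> cmod (x n) * cmod (y n)" by simp
  ultimately have "cmod (x n) * cmod (y n) \<le> (cmod (x n))\<^sup>2 + (cmod (y n))\<^sup>2" by linarith
  then show "norm (x n * cnj (y n)) \<le> (cmod (x n))\<^sup>2 + (cmod (y n))\<^sup>2"
    by (simp add: norm_mult)
qed

lemma Re_mult_cnj_self: "Re (z * cnj z) = (cmod z)\<^sup>2"
  by (metis Re_complex_of_real complex_norm_square)

instantiation ell2 :: ab_group_add
begin
lift_definition zero_ell2 :: ell2 is "\<lambda>_. 0" by simp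
lift_definition plus_ell2 :: "ell2 \<Rightarrow> ell2 \<Rightarrow> ell2" is "\<lambda>x y n. x n + y n"
  by (rule summable_cmod_add_sq)
lift_definition uminus_ell2 :: "ell2 \<Rightarrow> ell2" is "\<lambda>x n. - x n" by simp
definition minus_ell2 :: "ell2 \<Rightarrow> ell2 \<Rightarrow> ell2" where "minus_ell2 x y = x + - y"
instance
  by standard (simp_all add: minus_ell2_def, (transfer; simp add: fun_eq_iff algebra_simps)+)
end

lift_definition scaleC_ell2 :: "complex \<Rightarrow> ell2 \<Rightarrow> ell2" is "\<lambda>c x n. c * x n"
  by (simp add: norm_mult power_mult_distrib summable_mult)

interpretation ell2: vector_space scaleC_ell2
  by standard (transfer; simp add: algebra_simps)+

definition cinner_ell2 :: "ell2 \<Rightarrow> ell2 \<Rightarrow> complex" where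
  "cinner_ell2 x y = (\<Sum>n. ell2_nth x n * cnj (ell2_nth y n))"

lemma cinner_ell2_sums: "(\<lambda>n. ell2_nth x n * cnj (ell2_nth y n)) sums cinner_ell2 x y"
  unfolding cinner_ell2_def
  by (intro summable_sums summable_mult_cnj ell2_nth_summable)

text \<open>The real structure induced by the complex one: the norm is the usual \<open>\<ell>\<^sup>2\<close> norm.\<close>

instantiation ell2 :: real_inner
begin
definition scaleR_ell2 :: "real \<Rightarrow> ell2 \<Rightarrow> ell2" where
  "scaleR_ell2 r x = scaleC_ell2 (complex_of_real r) x"
definition inner_ell2 :: "ell2 \<Rightarrow> ell2 \<Rightarrow> real" where
  "inner_ell2 x y = Re (cinner_ell2 x y)"
definition norm_ell2 :: "ell2 \<Rightarrow> real" where
  "norm_ell2 x = sqrt (inner x x)"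
definition dist_ell2 :: "ell2 \<Rightarrow> ell2 \<Rightarrow> real" where
  "dist_ell2 x y = norm (x - y)"
definition sgn_ell2 :: "ell2 \<Rightarrow> ell2" where
  "sgn_ell2 x = inverse (norm x) *\<^sub>R x"
definition uniformity_ell2 :: "(ell2 \<times> ell2) filter" where
  "uniformity_ell2 = (INF e\<in>{0<..}. principal {(x, y). dist x y < e})"
definition open_ell2 :: "ell2 set \<Rightarrow> bool" where
  "open_ell2 U = (\<forall>x\<in>U. \<forall>\<^sub>F (x', y) in uniformity. x' = x \<longrightarrow> y \<in> U)"

instance
proof
  fix x y z :: ell2 and r s :: real
  have sums: "(\<lambda>n. Re (ell2_nth x n * cnj (ell2_nth y n))) sums inner x y" for x y
    unfolding inner_ell2_def by (rule sums_Re[OF cinner_ell2_sums])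
  show "r *\<^sub>R (x + y) = r *\<^sub>R x + r *\<^sub>R y"
    by (simp add: scaleR_ell2_def ell2.scale_right_distrib)
  show "(r + s) *\<^sub>R x = r *\<^sub>R x + s *\<^sub>R x"
    by (simp add: scaleR_ell2_def ell2.scale_left_distrib)
  show "r *\<^sub>R s *\<^sub>R x = (r * s) *\<^sub>R x" "1 *\<^sub>R x = x"
    by (simp_all add: scaleR_ell2_def)
  show "inner x y = inner y x"
    by (rule sums_unique2[OF sums[of x y]]) (use sums[of y x] in \<open>simp add: algebra_simps\<close>)
  show "inner (x + y) z = inner x z + inner y z"
    by (rule sums_unique2[OF sums])
      (use sums_add[OF sums[of x z] sums[of y z]] in \<open>simp add: plus_ell2.rep_eq algebra_simps\<close>)
  show "inner (r *\<^sub>R x) y = r * inner x y"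
    by (rule sums_unique2[OF sums])
      (use sums_mult[OF sums[of x y], of r] in
        \<open>simp add: scaleR_ell2_def scaleC_ell2.rep_eq algebra_simps\<close>)
  have sq: "(\<lambda>n. (cmod (ell2_nth x n))\<^sup>2) sums inner x x"
    using sums[of x x] by (simp only: Re_mult_cnj_self)
  show "0 \<le> inner x x"
    by (rule sums_le[OF _ sums_zero sq]) simp
  show "inner x x = 0 \<longleftrightarrow> x = 0"
  proof
    assume "inner x x = 0"
    then have "(\<lambda>n. (cmod (ell2_nth x n))\<^sup>2) sums 0" using sq by simp
    then have "\<And>n. (cmod (ell2_nth x n))\<^sup>2 = 0"
      using suminf_eq_zero_iff[of "\<lambda>n. (cmod (ell2_nth x n))\<^sup>2"] by (auto simp: sums_iff)
    then show "x = 0" by (intro ell2_eqI) (simp add: zero_ell2.rep_eq)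
  next
    assume "x = 0"
    then have "(\<lambda>n. 0) sums inner x x" using sq by (simp add: zero_ell2.rep_eq)
    then show "inner x x = 0" by (simp add: sums_iff)
  qed
qed (fact norm_ell2_def dist_ell2_def sgn_ell2_def uniformity_ell2_def open_ell2_def)+
end

lift_definition unit_ell2 :: "nat \<Rightarrow> ell2" is "\<lambda>j n. if n = j then 1 else 0"
  by (rule summable_finite[of "{_}"]) auto

section \<open>Compact operators on \<open>\<ell>\<^sup>2\<close> and their singular values\<close>

definition compact_operator :: "(ell2 \<Rightarrow> ell2) \<Rightarrow> bool" where
  "compact_operator T \<longleftrightarrow>
     Vector_Spaces.linear scaleC_ell2 scaleC_ell2 T \<and> compact (closure (T ` cball 0 1))"

definition has_matrix :: "(ell2 \<Rightarrow> ell2) \<Rightarrow> (nat \<Rightarrow> nat \<Rightarrow> complex) \<Rightarrow> bool" where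
  "has_matrix T A \<longleftrightarrow> (\<forall>i j. ell2_nth (T (unit_ell2 j)) i = A i j)"

definition cadjoint :: "(ell2 \<Rightarrow> ell2) \<Rightarrow> ell2 \<Rightarrow> ell2" where
  "cadjoint T = (SOME S. \<forall>x y. cinner_ell2 (T x) y = cinner_ell2 x (S y))"

text \<open>The positive singular values of a compact \<open>T\<close> are the \<open>\<sigma> > 0\<close> for which \<open>\<sigma>\<^sup>2\<close> is an
  eigenvalue of \<open>T\<^sup>*T\<close>, listed in nonincreasing order and repeated according to multiplicity; the
  list is padded with zeros if there are only finitely many. All eigenspaces below are
  finite-dimensional when \<open>T\<close> is compact, and \<open>ell2.dim\<close> is the dimension over the complex field.\<close>

definition singular_value_sequence :: "(ell2 \<Rightarrow> ell2) \<Rightarrow> (nat \<Rightarrow> real) \<Rightarrow> bool" where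
  "singular_value_sequence T \<Lambda> \<longleftrightarrow>
     decseq \<Lambda> \<and> (\<forall>k. 0 \<le> \<Lambda> k) \<and>
     (\<forall>\<sigma>>0. finite {k. \<Lambda> k = \<sigma>} \<and>
        card {k. \<Lambda> k = \<sigma>} =
          ell2.dim {x. cadjoint T (T x) = scaleC_ell2 (complex_of_real (\<sigma>\<^sup>2)) x})"

definition little_lp :: "ennreal \<Rightarrow> (nat \<Rightarrow> real) set" where
  "little_lp p =
     (if p = \<infinity> then {\<Lambda>. Bseq \<Lambda>} else {\<Lambda>. summable (\<lambda>k. \<bar>\<Lambda> k\<bar> powr enn2real p)})"

section \<open>Dirichlet series and Hankel forms\<close>

text \<open>A Dirichlet series \<open>\<Sum>\<^sub>n\<^sub>\<ge>\<^sub>1 a\<^sub>n n\<^sup>-\<^sup>s\<close> is represented by its coefficients. The value at index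
  \<open>0\<close> carries no meaning: it is required to vanish for polynomials and elements of \<open>H2\<close>, and is
  irrelevant for a formal symbol.\<close>

type_synonym dirichlet_series = "nat \<Rightarrow> complex"

definition dirichlet_polynomial :: "dirichlet_series \<Rightarrow> bool" where
  "dirichlet_polynomial f \<longleftrightarrow> f 0 = 0 \<and> finite {n. f n \<noteq> 0}"

definition H2 :: "dirichlet_series set" where
  "H2 = {f. f 0 = 0 \<and> summable (\<lambda>n. (cmod (f n))\<^sup>2)}"

definition H2_0 :: "dirichlet_series set" where
  "H2_0 = {f \<in> H2. f 1 = 0}"

definition dirichlet_mult :: "dirichlet_series \<Rightarrow> dirichlet_series \<Rightarrow> dirichlet_series" where
  "dirichlet_mult f g n = (\<Sum>d | d dvd n. f d * g (n div d))"

definition dirichlet_inner :: "dirichlet_series \<Rightarrow> dirichlet_series \<Rightarrow> complex" where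
  "dirichlet_inner f g = (\<Sum>n. f n * cnj (g n))"

definition hankel_form ::
    "dirichlet_series \<Rightarrow> dirichlet_series \<Rightarrow> dirichlet_series \<Rightarrow> complex" where
  "hankel_form \<phi> f g = dirichlet_inner (dirichlet_mult f g) \<phi>"

text \<open>The coefficients of the symbol are \<open>\<phi> n = cnj (\<rho> n)\<close>, so this is \<open>(\<rho>\<^sub>m\<^sub>n)\<^sub>m\<^sub>,\<^sub>n\<^sub>\<ge>\<^sub>2\<close>, with
  rows and columns renumbered from \<open>0\<close>.\<close>

definition hankel_matrix :: "dirichlet_series \<Rightarrow> nat \<Rightarrow> nat \<Rightarrow> complex" where
  "hankel_matrix \<phi> i j = cnj (\<phi> ((i + 2) * (j + 2)))"

definition hankel_in_schatten :: "ennreal \<Rightarrow> dirichlet_series \<Rightarrow> bool" where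
  "hankel_in_schatten p \<phi> \<longleftrightarrow>
     (\<exists>T \<Lambda>. compact_operator T \<and> has_matrix T (hankel_matrix \<phi>) \<and>
        singular_value_sequence T \<Lambda> \<and> \<Lambda> \<in> little_lp p)"

section \<open>The infinite torus and the Bohr lift\<close>

definition circle_measure :: "complex measure" where
  "circle_measure =
     distr (uniform_measure lborel {0..<2 * pi}) (restrict_space borel (sphere 0 1)) cis"

text \<open>The normalized Haar measure of the product group is the product of the normalized arc length
  measures; coordinate \<open>j\<close> (counted from \<open>0\<close>) belongs to the \<open>j\<close>-th prime.\<close>

definition torus_measure :: "(nat \<Rightarrow> complex) measure" where
  "torus_measure = (\<Pi>\<^sub>M j\<in>UNIV. circle_measure)"

definition L2_torus :: "((nat \<Rightarrow> complex) \<Rightarrow> complex) set" where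
  "L2_torus = {\<psi>. \<psi> \<in> borel_measurable torus_measure \<and>
     integrable torus_measure (\<lambda>z. (cmod (\<psi> z))\<^sup>2)}"

definition Linf_torus :: "((nat \<Rightarrow> complex) \<Rightarrow> complex) set" where
  "Linf_torus = {\<psi>. \<psi> \<in> borel_measurable torus_measure \<and>
     (\<exists>C. AE z in torus_measure. cmod (\<psi> z) \<le> C)}"

definition nth_prime :: "nat \<Rightarrow> nat" where
  "nth_prime j = enumerate {p. prime p} j"

definition kappa :: "nat \<Rightarrow> nat \<Rightarrow> nat" where
  "kappa n j = multiplicity (nth_prime j) n"

definition torus_monomial :: "nat \<Rightarrow> (nat \<Rightarrow> complex) \<Rightarrow> complex" where
  "torus_monomial n z = (\<Prod>j | kappa n j \<noteq> 0. z j ^ kappa n j)"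

definition bohr_lift :: "dirichlet_series \<Rightarrow> (nat \<Rightarrow> complex) \<Rightarrow> complex" where
  "bohr_lift f z = (\<Sum>n. f n * torus_monomial n z)"

definition torus_hankel_form ::
    "((nat \<Rightarrow> complex) \<Rightarrow> complex) \<Rightarrow> dirichlet_series \<Rightarrow> dirichlet_series \<Rightarrow> complex" where
  "torus_hankel_form \<psi> f g =
     (LINT z|torus_measure. bohr_lift f z * bohr_lift g z * cnj (\<psi> z))"

definition hankel_eq_on_H2_0 :: "dirichlet_series \<Rightarrow> ((nat \<Rightarrow> complex) \<Rightarrow> complex) \<Rightarrow> bool" where
  "hankel_eq_on_H2_0 \<phi> \<psi> \<longleftrightarrow>
     (\<forall>f\<in>H2_0. \<forall>g\<in>H2_0. dirichlet_polynomial f \<longrightarrow> dirichlet_polynomial g \<longrightarrow>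
        hankel_form \<phi> f g = torus_hankel_form \<psi> f g)"

definition bounded_symbol :: "dirichlet_series \<Rightarrow> ((nat \<Rightarrow> complex) \<Rightarrow> complex) \<Rightarrow> bool" where
  "bounded_symbol \<phi> \<psi> \<longleftrightarrow> \<psi> \<in> Linf_torus \<and> hankel_eq_on_H2_0 \<phi> \<psi>"

section \<open>Consistency facts\<close>

lemma prob_space_circle_measure: "prob_space circle_measure"
proof -
  have "cis \<in> borel_measurable (uniform_measure lborel {0..<2 * pi})"
    using borel_measurable_continuous_onI[OF continuous_on_cis[OF continuous_on_id]]
    by (simp cong: measurable_cong_sets)
  then have m: "cis \<in> measurable (uniform_measure lborel {0..<2 * pi})
      (restrict_space borel (sphere 0 1))"
    by (intro measurable_restrict_space2) auto
  have "prob_space (uniform_measure lborel {0..<2 * pi})"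
    by (rule prob_space_uniform_measure) auto
  then show ?thesis
    unfolding circle_measure_def by (rule prob_space.prob_space_distr[OF _ m])
qed

lemma prob_space_torus_measure: "prob_space torus_measure"
  unfolding torus_measure_def by (intro prob_space_PiM prob_space_circle_measure)

lemma space_torus_measure: "space torus_measure = UNIV \<rightarrow>\<^sub>E sphere 0 1"
  by (simp add: torus_measure_def circle_measure_def space_PiM space_restrict_space)

lemma norm_ell2_sq: "(norm x)\<^sup>2 = (\<Sum>n. (cmod (ell2_nth x n))\<^sup>2)"
proof -
  have "(\<lambda>n. Re (ell2_nth x n * cnj (ell2_nth x n))) sums inner x x"
    unfolding inner_ell2_def by (rule sums_Re[OF cinner_ell2_sums])
  then show ?thesis
    by (simp only: Re_mult_cnj_self dot_square_norm sums_iff)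
qed

lemma hankel_form_eq_sum:
  assumes f: "dirichlet_polynomial f" and g: "dirichlet_polynomial g"
  shows "hankel_form \<phi> f g = (\<Sum>m | f m \<noteq> 0. \<Sum>n | g n \<noteq> 0. f m * g n * cnj (\<phi> (m * n)))"
proof -
  let ?F = "{m. f m \<noteq> 0}" and ?G = "{n. g n \<noteq> 0}"
  let ?P = "(\<lambda>(m, n). m * n) ` (?F \<times> ?G)"
  have fin: "finite ?F" "finite ?G" and z: "f 0 = 0" "g 0 = 0"
    using f g by (auto simp: dirichlet_polynomial_def)
  have conv: "dirichlet_mult f g N =
      (\<Sum>(m, n) | (m, n) \<in> ?F \<times> ?G \<and> m * n = N. f m * g n)" for N
  proof (cases "N = 0")
    case True
    then show ?thesis using z by (auto simp: dirichlet_mult_def split_beta intro!: sum.neutral)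
  next
    case False
    have "dirichlet_mult f g N = (\<Sum>d | d dvd N \<and> f d \<noteq> 0 \<and> g (N div d) \<noteq> 0. f d * g (N div d))"
      unfolding dirichlet_mult_def using False by (intro sum.mono_neutral_right) auto
    also have "\<dots> = (\<Sum>(m, n) | (m, n) \<in> ?F \<times> ?G \<and> m * n = N. f m * g n)"
      using False by (intro sum.reindex_bij_witness[of _ fst "\<lambda>d. (d, N div d)"]) auto
    finally show ?thesis .
  qed
  have "dirichlet_mult f g N = 0" if "N \<notin> ?P" for N
    unfolding conv using that by (intro sum.neutral) auto
  then have "hankel_form \<phi> f g = (\<Sum>N\<in>?P. dirichlet_mult f g N * cnj (\<phi> N))"
    unfolding hankel_form_def dirichlet_inner_def using fin by (intro suminf_finite) auto
  also have "\<dots> = (\<Sum>N\<in>?P. \<Sum>x | x \<in> ?F \<times> ?G \<and> (case x of (m, n) \<Rightarrow> m * n) = N.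
      (case x of (m, n) \<Rightarrow> f m * g n * cnj (\<phi> (m * n))))"
    unfolding conv sum_distrib_right by (intro sum.cong refl) auto
  also have "\<dots> = (\<Sum>(m, n)\<in>?F \<times> ?G. f m * g n * cnj (\<phi> (m * n)))"
    using fin by (intro sum.group) auto
  finally show ?thesis using fin by (simp add: sum.cartesian_product)
qed

end

theory Submission
  imports Defs
begin

text \<open>Take a symbol carried by the squares of primes, with coefficient \<open>a\<^sub>k = (k + 1)\<^bsup>-1/2\<^esup>\<close> at the
  square of the \<open>k\<close>-th prime (\<open>k \<ge> 0\<close>). Once the index \<open>1\<close> is removed, the square \<open>q\<^sup>2\<close> of a prime
  factors only as \<open>q \<cdot> q\<close>,
  so the Hankel matrix is diagonal with singular values \<open>a\<^sub>k\<close>, which lie in \<open>\<ell>\<^sup>p\<close> for every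
  \<open>p > 2\<close>. A symbol \<open>\<psi>\<close> in \<open>L\<^sup>2\<close> would have the numbers \<open>a\<^sub>k\<close> as Fourier coefficients at the
  orthonormal functions \<open>z\<^sub>k\<^sup>2\<close>, contradicting Bessel's inequality since \<open>(a\<^sub>k)\<close> is not square
  summable.\<close>

section \<open>Diagonal operators on \<open>\<ell>\<^sup>2\<close>\<close>

text \<open>An unbounded multiplier can push a vector out of the sequence space, so the operator is
  set to zero when \<open>d\<close> is unbounded. This makes the map total.\<close>

lift_definition diag_ell2 :: "(nat \<Rightarrow> real) \<Rightarrow> ell2 \<Rightarrow> ell2" is
  "\<lambda>d x i. if Bseq d then complex_of_real (d i) * x i else 0"
proof -
  fix d :: "nat \<Rightarrow> real" and x :: "nat \<Rightarrow> complex"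
  assume x: "summable (\<lambda>n. (cmod (x n))\<^sup>2)"
  show "summable (\<lambda>n. (cmod (if Bseq d then complex_of_real (d n) * x n else 0))\<^sup>2)"
  proof (cases "Bseq d")
    case True
    then obtain C where C: "\<And>n. \<bar>d n\<bar> \<le> C" unfolding Bseq_def by auto
    have "summable (\<lambda>n. (cmod (complex_of_real (d n) * x n))\<^sup>2)"
    proof (rule summable_comparison_test')
      show "summable (\<lambda>n. C\<^sup>2 * (cmod (x n))\<^sup>2)" by (intro summable_mult x)
      show "norm ((cmod (complex_of_real (d n) * x n))\<^sup>2) \<le> C\<^sup>2 * (cmod (x n))\<^sup>2" for n
        using power_mono[OF C[of n], of 2]
        by (auto simp: norm_mult power_mult_distrib intro: mult_right_mono)
    qed
    then show ?thesis using True by simp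
  qed simp
qed

lemma ell2_nth_diag: "Bseq d \<Longrightarrow> ell2_nth (diag_ell2 d x) i = complex_of_real (d i) * ell2_nth x i"
  by (simp add: diag_ell2.rep_eq)

lemma linear_diag_ell2: "Vector_Spaces.linear scaleC_ell2 scaleC_ell2 (diag_ell2 d)"
proof
  show "diag_ell2 d (x + y) = diag_ell2 d x + diag_ell2 d y" for x y
    by (rule ell2_eqI) (simp add: diag_ell2.rep_eq plus_ell2.rep_eq algebra_simps)
  show "diag_ell2 d (scaleC_ell2 c x) = scaleC_ell2 c (diag_ell2 d x)" for c x
    by (rule ell2_eqI) (simp add: diag_ell2.rep_eq scaleC_ell2.rep_eq algebra_simps)
qed

lemma ell2_nth_diff: "ell2_nth (x - y) i = ell2_nth x i - ell2_nth y i"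
  unfolding minus_ell2_def plus_ell2.rep_eq uminus_ell2.rep_eq by simp

lemma diag_ell2_diff: "diag_ell2 d (x - y) = diag_ell2 d x - diag_ell2 d y"
  by (rule ell2_eqI)
    (simp add: diag_ell2.rep_eq ell2_nth_diff algebra_simps)

lemma has_matrix_diag_ell2:
  assumes "Bseq d" and "\<And>i j. A i j = (if i = j then complex_of_real (d i) else 0)"
  shows "has_matrix (diag_ell2 d) A"
  using assms by (simp add: has_matrix_def ell2_nth_diag unit_ell2.rep_eq)

text \<open>The series is split at \<open>N\<close>. The head involves finitely many coordinates of
  \<open>z\<close> and is controlled by coordinatewise convergence, while the tail is small
  uniformly on norm-bounded sets.\<close>

lemma norm_diag_ell2_le:
  assumes d: "Bseq d" and C: "\<And>i. \<bar>d i\<bar> \<le> C" and N: "\<And>i. N \<le> i \<Longrightarrow> \<bar>d i\<bar> \<le> \<epsilon>"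
  shows "(norm (diag_ell2 d z))\<^sup>2 \<le> C\<^sup>2 * (\<Sum>i<N. (cmod (ell2_nth z i))\<^sup>2) + \<epsilon>\<^sup>2 * (norm z)\<^sup>2"
proof -
  let ?z = "\<lambda>i. (cmod (ell2_nth z i))\<^sup>2"
  let ?h = "\<lambda>i. if i \<in> {..<N} then C\<^sup>2 * ?z i else 0"
  have h: "?h sums (\<Sum>i<N. C\<^sup>2 * ?z i)"
    by (rule sums_If_finite_set) simp
  have z: "?z sums (norm z)\<^sup>2"
    unfolding norm_ell2_sq by (intro summable_sums ell2_nth_summable)
  have "(norm (diag_ell2 d z))\<^sup>2 \<le> (\<Sum>i<N. C\<^sup>2 * ?z i) + \<epsilon>\<^sup>2 * (norm z)\<^sup>2"
  proof (rule sums_le)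
    show "(\<lambda>i. (cmod (ell2_nth (diag_ell2 d z) i))\<^sup>2) sums (norm (diag_ell2 d z))\<^sup>2"
      unfolding norm_ell2_sq by (intro summable_sums ell2_nth_summable)
    show "(\<lambda>i. ?h i + \<epsilon>\<^sup>2 * ?z i) sums ((\<Sum>i<N. C\<^sup>2 * ?z i) + \<epsilon>\<^sup>2 * (norm z)\<^sup>2)"
      by (intro sums_add sums_mult h z)
    show "(cmod (ell2_nth (diag_ell2 d z) i))\<^sup>2 \<le> ?h i + \<epsilon>\<^sup>2 * ?z i" for i
    proof (cases "i < N")
      case True
      have "(d i)\<^sup>2 * ?z i \<le> C\<^sup>2 * ?z i"
        using power_mono[OF C[of i], of 2] by (auto intro: mult_right_mono)
      moreover have "0 \<le> \<epsilon>\<^sup>2 * ?z i" by simp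
      ultimately have "(d i)\<^sup>2 * ?z i \<le> C\<^sup>2 * ?z i + \<epsilon>\<^sup>2 * ?z i" by linarith
      then show ?thesis using True by (simp add: ell2_nth_diag[OF d] norm_mult power_mult_distrib)
    next
      case False
      then show ?thesis using power_mono[OF N[of i], of 2]
        by (auto simp: ell2_nth_diag[OF d] norm_mult power_mult_distrib intro: mult_right_mono)
    qed
  qed
  then show ?thesis by (simp add: sum_distrib_left)
qed

text \<open>The unit ball of \<open>\<ell>\<^sup>2\<close> is compact for coordinatewise convergence (Tychonoff), and a diagonal
  operator with entries tending to \<open>0\<close> is continuous from this topology to the norm topology. This
  avoids completeness of \<open>ell2\<close>.\<close>

lemma compact_l2_ball: "compact {x :: nat \<Rightarrow> complex. \<forall>n. (\<Sum>i<n. (cmod (x i))\<^sup>2) \<le> 1}"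
proof -
  have "compactin (product_topology (\<lambda>i::nat. euclidean) UNIV) (\<Pi>\<^sub>E i\<in>UNIV. cball (0::complex) 1)"
    by (simp add: compactin_PiE)
  then have 1: "compact (\<Pi>\<^sub>E i\<in>(UNIV::nat set). cball (0::complex) 1)"
    by (simp add: euclidean_product_topology)
  \<comment> \<open>Bounding every partial sum, rather than the series, makes the ball an
    intersection of closed conditions on finitely many coordinates each.\<close>
  have 2: "closed {x :: nat \<Rightarrow> complex. \<forall>n. (\<Sum>i<n. (cmod (x i))\<^sup>2) \<le> 1}"
    by (intro closed_Collect_all closed_Collect_le continuous_intros continuous_on_product_coordinates)
  have 3: "x \<in> (\<Pi>\<^sub>E i\<in>UNIV. cball 0 1)" if x: "\<forall>n. (\<Sum>i<n. (cmod (x i))\<^sup>2) \<le> 1"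
    for x :: "nat \<Rightarrow> complex"
  proof -
    have "cmod (x i) \<le> 1" for i
    proof -
      have "(cmod (x i))\<^sup>2 \<le> (\<Sum>i<Suc i. (cmod (x i))\<^sup>2)"
        by (rule member_le_sum) auto
      then have "(cmod (x i))\<^sup>2 \<le> 1" using x order_trans by blast
      then show ?thesis by (simp add: power2_le_iff_abs_le abs_square_le_1)
    qed
    then show ?thesis by auto
  qed
  have "{x :: nat \<Rightarrow> complex. \<forall>n. (\<Sum>i<n. (cmod (x i))\<^sup>2) \<le> 1} =
      (\<Pi>\<^sub>E i\<in>UNIV. cball 0 1) \<inter> {x. \<forall>n. (\<Sum>i<n. (cmod (x i))\<^sup>2) \<le> 1}"
    using 3 by blast
  then show ?thesis using compact_Int_closed[OF 1 2] by simp
qed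

lemma compact_operator_diag_ell2:
  assumes lim: "d \<longlonglongrightarrow> 0"
  shows "compact_operator (diag_ell2 d)"
proof -
  define B where "B = {x :: nat \<Rightarrow> complex. \<forall>n. (\<Sum>i<n. (cmod (x i))\<^sup>2) \<le> 1}"
  let ?F = "\<lambda>x. diag_ell2 d (Abs_ell2 x)"
  have d: "Bseq d" by (rule convergent_imp_Bseq) (use lim in \<open>auto simp: convergent_def\<close>)
  then obtain C where C: "\<And>n. \<bar>d n\<bar> \<le> C" unfolding Bseq_def by auto
  have summ: "summable (\<lambda>n. (cmod (x n))\<^sup>2)" if "x \<in> B" for x
    by (rule summableI_nonneg_bounded[where x=1]) (use that in \<open>auto simp: B_def\<close>)
  have nth: "ell2_nth (Abs_ell2 x) = x" if "x \<in> B" for x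
    using summ[OF that] by (simp add: Abs_ell2_inverse)
  have norm_le: "norm (Abs_ell2 x) \<le> 1" if "x \<in> B" for x
  proof -
    have "(norm (Abs_ell2 x))\<^sup>2 \<le> 1"
      unfolding norm_ell2_sq nth[OF that]
      by (rule suminf_le_const[OF summ[OF that]]) (use that in \<open>auto simp: B_def\<close>)
    then show ?thesis by (simp add: abs_square_le_1)
  qed
  have ball: "ell2_nth x \<in> B" if "norm x \<le> 1" for x
  proof -
    have "(\<Sum>i<n. (cmod (ell2_nth x i))\<^sup>2) \<le> 1" for n
    proof -
      have "(\<Sum>i<n. (cmod (ell2_nth x i))\<^sup>2) \<le> (norm x)\<^sup>2"
        unfolding norm_ell2_sq by (rule sum_le_suminf[OF ell2_nth_summable]) auto
      also have "\<dots> \<le> 1" using that by (simp add: abs_square_le_1)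
      finally show ?thesis .
    qed
    then show ?thesis by (simp add: B_def)
  qed
  \<comment> \<open>\<open>B\<close> carries the product topology of
    \<open>nat \<Rightarrow> complex\<close>, in which it is compact, so only the continuity of
    \<open>?F\<close> into the norm topology remains.\<close>
  have img: "diag_ell2 d ` cball 0 1 = ?F ` B"
  proof
    show "diag_ell2 d ` cball 0 1 \<subseteq> ?F ` B"
    proof
      fix y assume "y \<in> diag_ell2 d ` cball 0 1"
      then obtain x where x: "norm x \<le> 1" "y = diag_ell2 d x" by auto
      then have "y = ?F (ell2_nth x)" by (simp add: ell2_nth_inverse)
      then show "y \<in> ?F ` B" using ball[OF x(1)] by blast
    qed
    show "?F ` B \<subseteq> diag_ell2 d ` cball 0 1" using norm_le by auto
  qed
  have "continuous_on B ?F"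
    unfolding continuous_on_def
  proof
    fix x assume x: "x \<in> B"
    show "(?F \<longlongrightarrow> ?F x) (at x within B)"
    proof (rule tendstoI)
      fix e :: real assume e: "0 < e"
      \<comment> \<open>Two points of the unit ball differ by norm at most 2, so the tail
        contributes at most \<open>(e / 4)\<^sup>2 * 2\<^sup>2 = e\<^sup>2 / 4\<close> to the
        squared distance. The head is made smaller than \<open>e\<^sup>2 / 4\<close> as
        well.\<close>
      obtain N where N: "\<And>i. N \<le> i \<Longrightarrow> \<bar>d i\<bar> \<le> e / 4"
        using LIMSEQ_D[OF lim, of "e / 4"] e by force
      let ?g = "\<lambda>y. C\<^sup>2 * (\<Sum>i<N. (cmod (y i - x i))\<^sup>2)"
      have "continuous_on UNIV ?g"
        by (intro continuous_intros continuous_on_product_coordinates)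
      then have "(?g \<longlongrightarrow> ?g x) (at x)" unfolding continuous_on_def by blast
      then have "(?g \<longlongrightarrow> ?g x) (at x within B)" using tendsto_within_subset subset_UNIV by blast
      then have "(?g \<longlongrightarrow> 0) (at x within B)" by simp
      then have "\<forall>\<^sub>F y in at x within B. ?g y < e\<^sup>2 / 4"
        by (rule order_tendstoD) (use e in simp)
      moreover have "\<forall>\<^sub>F y in at x within B. y \<in> B"
        unfolding eventually_at_filter by simp
      ultimately show "\<forall>\<^sub>F y in at x within B. dist (?F y) (?F x) < e"
      proof eventually_elim
        case (elim y)
        let ?z = "Abs_ell2 y - Abs_ell2 x"
        have nz: "ell2_nth ?z i = y i - x i" for i
          by (simp add: ell2_nth_diff nth[OF x] nth[OF elim(2)])
        have "norm ?z \<le> 2"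
          using norm_triangle_ineq4[of "Abs_ell2 y" "Abs_ell2 x"] norm_le[OF x] norm_le[OF elim(2)]
          by linarith
        then have "(norm ?z)\<^sup>2 \<le> 2\<^sup>2" by (rule power_mono) simp
        then have "(e / 4)\<^sup>2 * (norm ?z)\<^sup>2 \<le> (e / 4)\<^sup>2 * 2\<^sup>2" by (rule mult_left_mono) simp
        also have "\<dots> = e\<^sup>2 / 4" by (simp add: power2_eq_square)
        finally have "(norm (diag_ell2 d ?z))\<^sup>2 < e\<^sup>2 / 4 + e\<^sup>2 / 4"
          using norm_diag_ell2_le[where z = ?z and N = N, OF d C N] elim(1) unfolding nz by linarith
        also have "\<dots> \<le> e\<^sup>2" by simp
        finally have "norm (diag_ell2 d ?z) < e" by (rule power2_less_imp_less) (use e in simp)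
        then show ?case by (simp add: dist_norm diag_ell2_diff)
      qed
    qed
  qed
  then have "compact (diag_ell2 d ` cball 0 1)"
    unfolding img by (rule compact_continuous_image[OF _ compact_l2_ball[folded B_def]])
  then show ?thesis
    by (simp add: compact_operator_def linear_diag_ell2 closure_closed compact_imp_closed)
qed

section \<open>Adjoints and singular values of diagonal operators\<close>

lemma cinner_unit_ell2: "cinner_ell2 (unit_ell2 i) y = cnj (ell2_nth y i)"
proof -
  have "(\<lambda>n. ell2_nth (unit_ell2 i) n * cnj (ell2_nth y n)) =
      (\<lambda>n. if n = i then cnj (ell2_nth y n) else 0)"
    by (auto simp: unit_ell2.rep_eq)
  then show ?thesis unfolding cinner_ell2_def
    using sums_unique[OF sums_single[of i "\<lambda>n. cnj (ell2_nth y n)"]] by simp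
qed

text \<open>\<open>cadjoint\<close> is a choice, so uniqueness has to be shown: pairing with the
  unit vectors recovers every coordinate of the candidate.\<close>

lemma cadjoint_eqI:
  assumes "\<And>x y. cinner_ell2 (T x) y = cinner_ell2 x (S y)"
  shows "cadjoint T = S"
  unfolding cadjoint_def
proof (rule some_equality)
  fix S' assume S': "\<forall>x y. cinner_ell2 (T x) y = cinner_ell2 x (S' y)"
  show "S' = S"
  proof (intro ext ell2_eqI)
    fix y i
    have "cinner_ell2 (unit_ell2 i) (S' y) = cinner_ell2 (unit_ell2 i) (S y)"
      using S' assms by metis
    then show "ell2_nth (S' y) i = ell2_nth (S y) i" by (simp add: cinner_unit_ell2)
  qed
qed (use assms in blast)

lemma cadjoint_diag_ell2: "Bseq d \<Longrightarrow> cadjoint (diag_ell2 d) = diag_ell2 d"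
  by (rule cadjoint_eqI) (simp add: cinner_ell2_def ell2_nth_diag mult_ac)

text \<open>\<open>T\<^sup>*T\<close> is diagonal with entries \<open>(d i)\<^sup>2\<close>, so its
  eigenspace for \<open>\<sigma>\<^sup>2\<close> consists of the vectors supported where
  \<open>d i = \<sigma>\<close>. Strict decrease of \<open>\<Lambda>\<close> and injectivity of
  \<open>e\<close> leave at most one such index, hence a line or zero. The map \<open>e\<close>
  allows the diagonal to list the values with zeros in between.\<close>

lemma singular_value_sequence_diag_ell2:
  fixes e :: "nat \<Rightarrow> nat" and \<Lambda> d :: "nat \<Rightarrow> real"
  assumes d: "Bseq d" and dec: "\<And>m n. m < n \<Longrightarrow> \<Lambda> n < \<Lambda> m" and pos: "\<And>k. 0 < \<Lambda> k"
    and inj: "inj e" and on: "\<And>k. d (e k) = \<Lambda> k" and off: "\<And>i. i \<notin> range e \<Longrightarrow> d i = 0"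
  shows "singular_value_sequence (diag_ell2 d) \<Lambda>"
  unfolding singular_value_sequence_def
proof (intro conjI allI impI)
  show "decseq \<Lambda>" using dec by (metis decseq_def order_le_less)
  show "0 \<le> \<Lambda> k" for k using pos by (simp add: less_imp_le)
  have injL: "\<Lambda> m = \<Lambda> n \<longleftrightarrow> m = n" for m n using dec by (metis less_irrefl nat_neq_iff)
  fix \<sigma> :: real assume \<sigma>: "0 < \<sigma>"
  \<comment> \<open>Nonnegativity turns \<open>(d i)\<^sup>2 = \<sigma>\<^sup>2\<close> into
    \<open>d i = \<sigma>\<close>.\<close>
  have nonneg: "0 \<le> d i" for i
    using on off pos by (metis less_imp_le order_refl rangeE)
  have "cadjoint (diag_ell2 d) (diag_ell2 d x) = scaleC_ell2 (complex_of_real (\<sigma>\<^sup>2)) x \<longleftrightarrow>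
      (\<forall>i. d i \<noteq> \<sigma> \<longrightarrow> ell2_nth x i = 0)" for x
  proof -
    have "cadjoint (diag_ell2 d) (diag_ell2 d x) = scaleC_ell2 (complex_of_real (\<sigma>\<^sup>2)) x \<longleftrightarrow>
        (\<forall>i. complex_of_real ((d i)\<^sup>2) * ell2_nth x i = complex_of_real (\<sigma>\<^sup>2) * ell2_nth x i)"
      unfolding cadjoint_diag_ell2[OF d] ell2_nth_inject[symmetric]
      by (simp add: fun_eq_iff ell2_nth_diag[OF d] scaleC_ell2.rep_eq power2_eq_square mult.assoc)
    also have "\<dots> \<longleftrightarrow> (\<forall>i. d i \<noteq> \<sigma> \<longrightarrow> ell2_nth x i = 0)"
      unfolding mult_right_cancel of_real_eq_iff mult_cancel_right
      using nonneg \<sigma> by (simp add: power2_eq_iff_nonneg) blast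
    finally show ?thesis .
  qed
  then have E: "{x. cadjoint (diag_ell2 d) (diag_ell2 d x) = scaleC_ell2 (complex_of_real (\<sigma>\<^sup>2)) x} =
      {x. \<forall>i. d i \<noteq> \<sigma> \<longrightarrow> ell2_nth x i = 0}" by simp
  have "finite {k. \<Lambda> k = \<sigma>} \<and> card {k. \<Lambda> k = \<sigma>} = ell2.dim {x. \<forall>i. d i \<noteq> \<sigma> \<longrightarrow> ell2_nth x i = 0}"
  proof (cases "\<exists>k. \<Lambda> k = \<sigma>")
    case True
    then obtain k where k: "\<Lambda> k = \<sigma>" by blast
    have K: "{k. \<Lambda> k = \<sigma>} = {k}" using k injL by auto
    have iff: "d i = \<sigma> \<longleftrightarrow> i = e k" for i
      using on off k injL \<sigma> by (metis less_irrefl rangeE)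
    have "{x. \<forall>i. d i \<noteq> \<sigma> \<longrightarrow> ell2_nth x i = 0} = ell2.span {unit_ell2 (e k)}"
    proof -
      have "(\<forall>i. d i \<noteq> \<sigma> \<longrightarrow> ell2_nth x i = 0) \<longleftrightarrow> (\<exists>c. x = scaleC_ell2 c (unit_ell2 (e k)))" for x
      proof
        assume "\<forall>i. d i \<noteq> \<sigma> \<longrightarrow> ell2_nth x i = 0"
        then have "x = scaleC_ell2 (ell2_nth x (e k)) (unit_ell2 (e k))"
          by (intro ell2_eqI) (simp add: iff scaleC_ell2.rep_eq unit_ell2.rep_eq)
        then show "\<exists>c. x = scaleC_ell2 c (unit_ell2 (e k))" by blast
      qed (auto simp: iff scaleC_ell2.rep_eq unit_ell2.rep_eq)
      then show ?thesis by (auto simp: ell2.span_singleton)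
    qed
    moreover have "unit_ell2 (e k) \<noteq> 0"
    proof
      assume "unit_ell2 (e k) = 0"
      then have "ell2_nth (unit_ell2 (e k)) (e k) = ell2_nth 0 (e k)" by simp
      then show False by (simp add: unit_ell2.rep_eq zero_ell2.rep_eq)
    qed
    then have "ell2.dim (ell2.span {unit_ell2 (e k)}) = 1"
      by (subst ell2.dim_span_eq_card_independent) (auto simp: ell2.independent_insert)
    ultimately show ?thesis by (simp add: K)
  next
    case False
    then have "d i \<noteq> \<sigma>" for i using on off \<sigma> by (metis less_irrefl rangeE)
    then have "{x. \<forall>i. d i \<noteq> \<sigma> \<longrightarrow> ell2_nth x i = 0} = {0}"
      by (auto simp: zero_ell2.rep_eq intro!: ell2_eqI)
    moreover have "ell2.dim {0} = 0"
      using ell2.dim_span_eq_card_independent[of "{}"] by (simp add: ell2.independent_empty)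
    ultimately show ?thesis using False by simp
  qed
  then show "finite {k. \<Lambda> k = \<sigma>}"
    and "card {k. \<Lambda> k = \<sigma>} =
      ell2.dim {x. cadjoint (diag_ell2 d) (diag_ell2 d x) = scaleC_ell2 (complex_of_real (\<sigma>\<^sup>2)) x}"
    unfolding E by auto
qed

section \<open>Bessel's inequality on the torus\<close>

lemma integrable_mult_cnj_of_sq:
  fixes f g :: "'a \<Rightarrow> complex"
  assumes [measurable]: "f \<in> borel_measurable M" "g \<in> borel_measurable M"
    and "integrable M (\<lambda>x. (cmod (f x))\<^sup>2)" "integrable M (\<lambda>x. (cmod (g x))\<^sup>2)"
  shows "integrable M (\<lambda>x. f x * cnj (g x))"
proof -
  have [measurable]: "cnj \<in> borel_measurable borel"
    by (intro borel_measurable_continuous_onI continuous_intros)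
  show ?thesis
  proof (rule Bochner_Integration.integrable_bound)
    show "integrable M (\<lambda>x. (cmod (f x))\<^sup>2 + (cmod (g x))\<^sup>2)" using assms by simp
    show "AE x in M. norm (f x * cnj (g x)) \<le> norm ((cmod (f x))\<^sup>2 + (cmod (g x))\<^sup>2)"
    proof (rule AE_I2)
      fix x
      have "2 * (cmod (f x) * cmod (g x)) \<le> (cmod (f x))\<^sup>2 + (cmod (g x))\<^sup>2"
        using zero_le_power2[of "cmod (f x) - cmod (g x)"] by (simp add: power2_diff)
      moreover have "0 \<le> cmod (f x) * cmod (g x)" by simp
      ultimately have "cmod (f x) * cmod (g x) \<le> (cmod (f x))\<^sup>2 + (cmod (g x))\<^sup>2" by linarith
      then show "norm (f x * cnj (g x)) \<le> norm ((cmod (f x))\<^sup>2 + (cmod (g x))\<^sup>2)"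
        by (simp add: norm_mult)
    qed
  qed measurable
qed

text \<open>The squared distance from \<psi> to its orthogonal projection onto the span of the
  \<open>e j\<close> with \<open>j \<in> J\<close> is nonnegative, and it equals the squared norm of
  \<psi> minus the sum on the left.\<close>

lemma bessel_inequality_integral:
  fixes e :: "'i \<Rightarrow> 'a \<Rightarrow> complex" and \<psi> :: "'a \<Rightarrow> complex"
  assumes J: "finite J"
    and e: "\<And>j. e j \<in> borel_measurable M" "\<And>j. integrable M (\<lambda>x. (cmod (e j x))\<^sup>2)"
    and \<psi>: "\<psi> \<in> borel_measurable M" "integrable M (\<lambda>x. (cmod (\<psi> x))\<^sup>2)"
    and on: "\<And>j k. (LINT x|M. e j x * cnj (e k x)) = (if j = k then 1 else 0)"
  shows "(\<Sum>j\<in>J. (cmod (LINT x|M. e j x * cnj (\<psi> x)))\<^sup>2) \<le> (LINT x|M. (cmod (\<psi> x))\<^sup>2)"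
proof -
  define c where "c j = (LINT x|M. e j x * cnj (\<psi> x))" for j
  \<comment> \<open>Since \<open>c j\<close> pairs \<open>e j\<close> with \<psi>, the Fourier
    coefficient of \<psi> at \<open>e j\<close> is \<open>cnj (c j)\<close>; \<open>S\<close> is the
    projection.\<close>
  define S where "S x = (\<Sum>j\<in>J. cnj (c j) * e j x)" for x
  define s where "s = (\<Sum>j\<in>J. (cmod (c j))\<^sup>2)"
  have ee: "integrable M (\<lambda>x. e j x * cnj (e k x))" for j k
    by (intro integrable_mult_cnj_of_sq e)
  have e\<psi>: "integrable M (\<lambda>x. e j x * cnj (\<psi> x))" for j
    by (intro integrable_mult_cnj_of_sq e \<psi>)
  have \<psi>\<psi>: "integrable M (\<lambda>x. \<psi> x * cnj (\<psi> x))"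
    by (intro integrable_mult_cnj_of_sq \<psi>)
  have cc: "cnj (c j) * c j = complex_of_real ((cmod (c j))\<^sup>2)" for j
    by (metis complex_norm_square mult.commute)
  have S\<psi>': "S x * cnj (\<psi> x) = (\<Sum>j\<in>J. cnj (c j) * (e j x * cnj (\<psi> x)))" for x
    by (simp add: S_def sum_distrib_right mult.assoc)
  have S\<psi>: "integrable M (\<lambda>x. S x * cnj (\<psi> x))" "(LINT x|M. S x * cnj (\<psi> x)) = s"
    unfolding S\<psi>' using e\<psi> by (simp_all add: s_def c_def[symmetric] cc)
  have SS': "S x * cnj (S x) = (\<Sum>j\<in>J. \<Sum>k\<in>J. cnj (c j) * (c k * (e j x * cnj (e k x))))" for x
    unfolding S_def cnj_sum sum_product by (intro sum.cong) (simp_all add: mult_ac)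
  have SS: "integrable M (\<lambda>x. S x * cnj (S x))" "(LINT x|M. S x * cnj (S x)) = s"
    unfolding SS' using ee J
    by (simp_all add: on s_def cc if_distrib[of "(*) _"] sum.delta cong: if_cong)
  have expand: "(\<psi> x - S x) * cnj (\<psi> x - S x) =
      \<psi> x * cnj (\<psi> x) - S x * cnj (\<psi> x) - cnj (S x * cnj (\<psi> x)) + S x * cnj (S x)" for x
    by (simp add: algebra_simps)
  \<comment> \<open>Each cross term integrates to the real number \<open>s\<close>, and so does the
    last term, so the total correction is \<open>- s - s + s = - s\<close>.\<close>
  have "(LINT x|M. (\<psi> x - S x) * cnj (\<psi> x - S x)) = (LINT x|M. \<psi> x * cnj (\<psi> x)) - s"
    unfolding expand
  proof (subst Bochner_Integration.integral_add)
    show "(LINT x|M. \<psi> x * cnj (\<psi> x) - S x * cnj (\<psi> x) - cnj (S x * cnj (\<psi> x))) +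
        (LINT x|M. S x * cnj (S x)) = (LINT x|M. \<psi> x * cnj (\<psi> x)) - s"
    proof (subst Bochner_Integration.integral_diff)
      show "(LINT x|M. \<psi> x * cnj (\<psi> x) - S x * cnj (\<psi> x)) - (LINT x|M. cnj (S x * cnj (\<psi> x))) +
        (LINT x|M. S x * cnj (S x)) = (LINT x|M. \<psi> x * cnj (\<psi> x)) - s"
        unfolding Bochner_Integration.integral_cnj S\<psi> SS using \<psi>\<psi> S\<psi> by simp
    qed (intro Bochner_Integration.integrable_diff integrable_cnj \<psi>\<psi> S\<psi>)+
  qed (intro Bochner_Integration.integrable_diff integrable_cnj \<psi>\<psi> S\<psi> SS)+
  moreover have sq: "z * cnj z = complex_of_real ((cmod z)\<^sup>2)" for z
    by (rule complex_norm_square[symmetric])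
  ultimately have "complex_of_real (LINT x|M. (cmod (\<psi> x - S x))\<^sup>2) =
      complex_of_real ((LINT x|M. (cmod (\<psi> x))\<^sup>2) - s)"
    unfolding sq integral_complex_of_real by simp
  then have "(LINT x|M. (cmod (\<psi> x - S x))\<^sup>2) = (LINT x|M. (cmod (\<psi> x))\<^sup>2) - s"
    by (simp only: of_real_eq_iff)
  moreover have "0 \<le> (LINT x|M. (cmod (\<psi> x - S x))\<^sup>2)" by simp
  ultimately show ?thesis unfolding s_def c_def by linarith
qed

section \<open>Moments on the circle and orthonormality on the torus\<close>

text \<open>Pulled back along \<open>cis\<close>, the integrand has the periodic antiderivative
  \<open>cis (n * t) / (\<i> * n)\<close> up to the factor \<open>1 / (2 * pi)\<close>, and its
  boundary values cancel.\<close>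

lemma circle_measure_power_integral:
  assumes "0 < n"
  shows "(LINT z|circle_measure. z ^ n) = 0"
proof -
  have [measurable]: "cis \<in> borel_measurable borel"
    by (intro borel_measurable_continuous_onI continuous_on_cis continuous_on_id)
  have [measurable]: "cis \<in> measurable (uniform_measure lborel {0..<2 * pi})
      (restrict_space borel (sphere 0 1))"
    by (intro measurable_restrict_space2) (auto simp: measurable_cong_sets[OF sets_uniform_measure refl])
  have "(\<lambda>z::complex. z ^ n) \<in> borel_measurable (restrict_space borel (sphere 0 1))"
    by (intro measurable_restrict_space1) simp
  then have "(LINT z|circle_measure. z ^ n) = (LINT t|uniform_measure lborel {0..<2 * pi}. cis t ^ n)"
    unfolding circle_measure_def by (intro integral_distr) auto
  also have "uniform_measure lborel {0..<2 * pi} =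
      density lborel (\<lambda>t. ennreal (indicator {0..<2 * pi} t / (2 * pi)))"
    unfolding uniform_measure_def
    by (intro density_cong) (auto simp: divide_ennreal[symmetric] split: split_indicator)
  also have "(LINT t|\<dots>. cis t ^ n) =
      (LINT t|lborel. (indicator {0..<2 * pi} t / (2 * pi)) *\<^sub>R cis t ^ n)"
    by (intro integral_density) auto
  \<comment> \<open>The fundamental theorem is applied on a closed interval; adding the endpoint
    \<open>2 * pi\<close> changes the integrand on a null set only.\<close>
  also have "\<dots> = (LINT t|lborel. indicator {0..2 * pi} t *\<^sub>R ((1 / (2 * pi)) *\<^sub>R cis t ^ n))"
  proof (intro integral_cong_AE)
    show "AE t in lborel. (indicator {0..<2 * pi} t / (2 * pi)) *\<^sub>R cis t ^ n =
        indicator {0..2 * pi} t *\<^sub>R ((1 / (2 * pi)) *\<^sub>R cis t ^ n)"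
      using AE_lborel_singleton[of "2 * pi"] by eventually_elim (auto split: split_indicator)
  qed auto
  also have "\<dots> = (1 / (2 * pi)) *\<^sub>R (cis (n * (2 * pi)) / (\<i> * n)) - (1 / (2 * pi)) *\<^sub>R (cis (of_nat n * 0) / (\<i> * n))"
  proof (rule integral_FTC_atLeastAtMost[where F="\<lambda>t. (1 / (2 * pi)) *\<^sub>R (cis (n * t) / (\<i> * n))"])
    fix t
    have "((\<lambda>t. exp (\<i> * of_nat n * complex_of_real t) / (\<i> * n)) has_vector_derivative
        exp (\<i> * of_nat n * complex_of_real t)) (at t within {0..2 * pi})"
      using assms by (auto intro!: derivative_eq_intros has_vector_derivative_real_field)
    then have "((\<lambda>t. cis (n * t) / (\<i> * n)) has_vector_derivative cis t ^ n) (at t within {0..2 * pi})"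
      unfolding Complex.DeMoivre by (simp add: cis_conv_exp mult_ac)
    then show "((\<lambda>t. (1 / (2 * pi)) *\<^sub>R (cis (n * t) / (\<i> * n))) has_vector_derivative
        (1 / (2 * pi)) *\<^sub>R cis t ^ n) (at t within {0..2 * pi})"
      by (rule bounded_linear.has_vector_derivative[OF bounded_linear_scaleR_right])
  qed (auto intro!: continuous_intros)
  also have "cis (n * (2 * pi)) = 1"
    using cis_multiple_2pi[of "real n"] by (simp add: mult_ac)
  finally show ?thesis by simp
qed

text \<open>The integrand depends only on the coordinates in \<open>J\<close>. Restriction to
  \<open>J\<close> carries the torus measure to a finite product measure, where the integral of the
  product factors.\<close>

lemma torus_integral_prod:
  fixes h :: "nat \<Rightarrow> complex \<Rightarrow> complex"
  assumes J: "finite J" and h: "\<And>j. j \<in> J \<Longrightarrow> integrable circle_measure (h j)"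
  shows "(LINT z|torus_measure. (\<Prod>j\<in>J. h j (z j))) = (\<Prod>j\<in>J. LINT w|circle_measure. h j w)"
proof -
  interpret circle: prob_space circle_measure by (rule prob_space_circle_measure)
  interpret product_prob_space "\<lambda>_::nat. circle_measure" UNIV by unfold_locales
  have hm: "(\<lambda>x. h j (x j)) \<in> borel_measurable (\<Pi>\<^sub>M j\<in>J. circle_measure)" if "j \<in> J" for j
    using measurable_compose[OF measurable_component_singleton[OF that]
        borel_measurable_integrable[OF h[OF that]]] .
  have "(\<Prod>j\<in>J. LINT w|circle_measure. h j w) = (LINT x|(\<Pi>\<^sub>M j\<in>J. circle_measure). (\<Prod>j\<in>J. h j (x j)))"
    by (rule product_integral_prod[symmetric, OF J h])
  also have "\<dots> = (LINT x|distr torus_measure (\<Pi>\<^sub>M j\<in>J. circle_measure) (\<lambda>x. restrict x J). (\<Prod>j\<in>J. h j (x j)))"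
    unfolding torus_measure_def by (subst distr_PiM_restrict_finite) (use J in auto)
  also have "\<dots> = (LINT x|torus_measure. (\<Prod>j\<in>J. h j (restrict x J j)))"
    unfolding torus_measure_def
    by (intro integral_distr measurable_restrict_subset borel_measurable_prod hm) auto
  also have "\<dots> = (LINT x|torus_measure. (\<Prod>j\<in>J. h j (x j)))" by simp
  finally show ?thesis by simp
qed

lemma circle_power_measurable: "(\<lambda>w::complex. w ^ n) \<in> borel_measurable circle_measure"
  unfolding circle_measure_def measurable_distr_eq1
  by (intro measurable_restrict_space1) simp

lemma torus_coordinate_measurable: "(\<lambda>z. z k ^ n) \<in> borel_measurable torus_measure"
  unfolding torus_measure_def
  by (rule measurable_compose[OF measurable_component_singleton[OF UNIV_I]])
    (rule circle_power_measurable)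

lemma norm_torus_coordinate: "z \<in> space torus_measure \<Longrightarrow> cmod (z k) = 1"
  by (auto simp: space_torus_measure PiE_def Pi_def)

text \<open>For equal indices the integrand is 1 on a probability space. For distinct ones the
  integral factors, and one factor is a vanishing moment of the circle.\<close>

lemma torus_coordinate_power_orthonormal:
  assumes n: "0 < n"
  shows "(LINT z|torus_measure. z j ^ n * cnj (z k ^ n)) = (if j = k then 1 else 0)"
proof (cases "j = k")
  case True
  interpret prob_space torus_measure by (rule prob_space_torus_measure)
  have "z j ^ n * cnj (z j ^ n) = 1" if "z \<in> space torus_measure" for z
    using norm_torus_coordinate[OF that, of j]
    by (metis complex_norm_square norm_power of_real_1 power_one)
  then have "(LINT z|torus_measure. z j ^ n * cnj (z j ^ n)) = (LINT z|torus_measure. 1)"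
    by (intro Bochner_Integration.integral_cong) auto
  then show ?thesis using True by (simp add: prob_space)
next
  case False
  interpret prob_space circle_measure by (rule prob_space_circle_measure)
  have int: "integrable circle_measure (\<lambda>w. w ^ n)"
    by (rule integrable_const_bound[where B=1])
      (use circle_power_measurable[of n] in \<open>auto simp: circle_measure_def space_restrict_space norm_power\<close>)
  \<comment> \<open>Only the indices \<open>j\<close> and \<open>k\<close> enter the product, so the
    second branch serves as the factor at \<open>k\<close>.\<close>
  define h where "h i w = (if i = j then w ^ n else cnj (w ^ n))" for i and w :: complex
  have "(LINT z|torus_measure. (\<Prod>i\<in>{j, k}. h i (z i))) = (\<Prod>i\<in>{j, k}. LINT w|circle_measure. h i w)"
  proof (rule torus_integral_prod)
    show "integrable circle_measure (h i)" for i
    proof (cases "i = j")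
      case False
      then have "h i = (\<lambda>w. cnj (w ^ n))" by (auto simp: h_def)
      then show ?thesis using integrable_cnj[OF int] by simp
    qed (use int in \<open>simp add: h_def[abs_def]\<close>)
  qed simp
  then show ?thesis using False circle_measure_power_integral[OF n] by (simp add: h_def)
qed

lemma torus_square_coefficients_bessel:
  assumes \<psi>: "\<psi> \<in> L2_torus" and J: "finite J"
  shows "(\<Sum>k\<in>J. (cmod (LINT z|torus_measure. z k ^ 2 * cnj (\<psi> z)))\<^sup>2)
    \<le> (LINT z|torus_measure. (cmod (\<psi> z))\<^sup>2)"
proof (rule bessel_inequality_integral[OF J])
  interpret prob_space torus_measure by (rule prob_space_torus_measure)
  note torus_coordinate_measurable[measurable]
  show "integrable torus_measure (\<lambda>z. (cmod (z k ^ 2))\<^sup>2)" for k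
  proof (rule integrable_const_bound[where B=1])
    show "AE z in torus_measure. norm ((cmod (z k ^ 2))\<^sup>2) \<le> 1"
      by (rule AE_I2) (simp add: norm_power norm_torus_coordinate)
  qed measurable
qed (use \<psi> in \<open>auto simp: L2_torus_def torus_coordinate_power_orthonormal[of 2, simplified]
      intro: torus_coordinate_measurable\<close>)

text \<open>The torus has total mass one. This reduces the claim on bounded symbols to the one on
  square integrable symbols.\<close>

lemma Linf_torus_subset_L2_torus: "Linf_torus \<subseteq> L2_torus"
proof
  fix \<psi> assume "\<psi> \<in> Linf_torus"
  then obtain C where m[measurable]: "\<psi> \<in> borel_measurable torus_measure"
    and C: "AE z in torus_measure. cmod (\<psi> z) \<le> C" by (auto simp: Linf_torus_def)
  interpret prob_space torus_measure by (rule prob_space_torus_measure)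
  have "integrable torus_measure (\<lambda>z. (cmod (\<psi> z))\<^sup>2)"
  proof (rule integrable_const_bound[where B="C\<^sup>2"])
    show "AE z in torus_measure. norm ((cmod (\<psi> z))\<^sup>2) \<le> C\<^sup>2"
      using C by eventually_elim (auto intro: power_mono)
  qed simp
  then show "\<psi> \<in> L2_torus" using m by (simp add: L2_torus_def)
qed

section \<open>Symbols supported on squares of primes\<close>

lemma prime_nth_prime: "prime (nth_prime k)"
  unfolding nth_prime_def using enumerate_in_set[OF primes_infinite] by blast

lemma inj_nth_prime: "inj nth_prime"
  unfolding nth_prime_def by (rule inj_enumerate[OF primes_infinite])

lemma two_le_nth_prime: "2 \<le> nth_prime k"
  by (rule prime_ge_2_nat[OF prime_nth_prime])

lemma torus_monomial_nth_prime: "torus_monomial (nth_prime k) z = z k"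
proof -
  have "kappa (nth_prime k) j = (if j = k then 1 else 0)" for j
    using prime_nth_prime[of j] prime_nth_prime[of k] inj_nth_prime
    by (auto simp: kappa_def inj_eq prime_multiplicity_other)
  then show ?thesis by (simp add: torus_monomial_def)
qed

text \<open>Injectivity of \<open>nth_prime\<close> makes the index under \<open>THE\<close> unique.
  The coefficients are real, so the conjugation in \<open>hankel_matrix\<close> has no
  effect.\<close>

definition prime_square_symbol :: "(nat \<Rightarrow> real) \<Rightarrow> dirichlet_series" where
  "prime_square_symbol a n =
     (if \<exists>k. n = (nth_prime k)\<^sup>2 then complex_of_real (a (THE k. n = (nth_prime k)\<^sup>2)) else 0)"

lemma prime_square_symbol_prime_square: "prime_square_symbol a ((nth_prime k)\<^sup>2) = complex_of_real (a k)"
proof -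
  have "(THE j. (nth_prime k)\<^sup>2 = (nth_prime j)\<^sup>2) = k"
    using inj_nth_prime by (intro the_equality) (auto simp: inj_eq)
  then show ?thesis by (auto simp: prime_square_symbol_def)
qed

text \<open>Both factors are powers of \<open>p\<close> whose exponents sum to 2. Excluding the
  factor 1 forces both exponents to be 1; this is where the restriction to series without constant
  term enters.\<close>

lemma mult_eq_prime_square:
  assumes "prime (p::nat)" "m * n = p\<^sup>2" "2 \<le> m" "2 \<le> n"
  shows "m = p \<and> n = p"
proof -
  obtain i j where ij: "m = p ^ i" "n = p ^ j" using prime_power_mult_nat[OF assms(1,2)] by blast
  have "p ^ (i + j) = p\<^sup>2" using assms(2) ij by (simp add: power_add)
  then have "i + j = 2" using prime_gt_1_nat[OF assms(1)] power_inject_exp by blast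
  moreover have "i \<noteq> 0" "j \<noteq> 0" using assms(3,4) ij by (auto intro: gr0I)
  ultimately have "i = 1" "j = 1" by auto
  then show ?thesis using ij by simp
qed

text \<open>The disjunction covers the off-diagonal entries of the Hankel matrix and the diagonal
  entries at nonprime indices together.\<close>

lemma prime_square_symbol_mult:
  assumes "2 \<le> m" "2 \<le> n" "m \<noteq> n \<or> m \<notin> range nth_prime"
  shows "prime_square_symbol a (m * n) = 0"
proof -
  have "m * n \<noteq> (nth_prime k)\<^sup>2" for k
    using mult_eq_prime_square[OF prime_nth_prime _ assms(1,2), of k] assms(3) by auto
  then show ?thesis by (simp add: prime_square_symbol_def)
qed

lemma hankel_in_schatten_prime_square_symbol:
  assumes dec: "\<And>m n. m < n \<Longrightarrow> a n < a m" and pos: "\<And>k. 0 < a k"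
    and lim: "a \<longlonglongrightarrow> 0" and lp: "a \<in> little_lp p"
  shows "hankel_in_schatten p (prime_square_symbol a)"
proof -
  let ?\<phi> = "prime_square_symbol a"
  \<comment> \<open>\<open>hankel_matrix\<close> numbers its rows from 0 although they belong to the
    integers from 2 on, hence the shift. The subtraction is not truncated, because primes are at
    least 2.\<close>
  define e where "e k = nth_prime k - 2" for k
  define d where "d i = Re (?\<phi> ((i + 2) * (i + 2)))" for i
  have e2: "e k + 2 = nth_prime k" for k using two_le_nth_prime[of k] by (simp add: e_def)
  have inj: "inj e" using inj_nth_prime e2 by (metis injD injI)
  have on: "d (e k) = a k" for k
    unfolding d_def e2 using prime_square_symbol_prime_square[of a k] by (simp add: power2_eq_square)
  have rng: "i + 2 \<notin> range nth_prime" if "i \<notin> range e" for i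
  proof
    assume "i + 2 \<in> range nth_prime"
    then obtain k where "i + 2 = nth_prime k" by blast
    then have "i = e k" by (simp add: e2[symmetric])
    then show False using that by blast
  qed
  have off: "d i = 0" if "i \<notin> range e" for i
    unfolding d_def using prime_square_symbol_mult[of "i + 2" "i + 2" a] rng[OF that] by simp
  \<comment> \<open>\<open>d\<close> is \<open>a\<close> spread out along \<open>e\<close> with
    zeros elsewhere. Convergence to 0 is expressed by the cofinite filter, which does not depend on
    the order: the exceptional set for \<open>d\<close> lies in the image under \<open>e\<close> of
    the finite one for \<open>a\<close>.\<close>
  have lim_d: "d \<longlonglongrightarrow> 0"
  proof (rule LIMSEQ_I)
    fix r :: real assume "0 < r"
    have "eventually (\<lambda>k. \<bar>a k\<bar> < r) cofinite"
      using tendstoD[OF lim \<open>0 < r\<close>] by (simp add: cofinite_eq_sequentially)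
    then have "finite (e ` {k. \<not> \<bar>a k\<bar> < r})" by (simp add: eventually_cofinite)
    moreover have "{i. \<not> \<bar>d i\<bar> < r} \<subseteq> e ` {k. \<not> \<bar>a k\<bar> < r}"
    proof
      fix i assume i: "i \<in> {i. \<not> \<bar>d i\<bar> < r}"
      then have "i \<in> range e" using off[of i] \<open>0 < r\<close> by force
      then show "i \<in> e ` {k. \<not> \<bar>a k\<bar> < r}" using i on by auto
    qed
    ultimately have "finite {i. \<not> \<bar>d i\<bar> < r}" by (rule finite_subset[rotated])
    then have "eventually (\<lambda>i. \<bar>d i\<bar> < r) sequentially"
      unfolding cofinite_eq_sequentially[symmetric] eventually_cofinite .
    then show "\<exists>N. \<forall>n\<ge>N. norm (d n - 0) < r" by (simp add: eventually_sequentially)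
  qed
  then have B: "Bseq d" by (intro convergent_imp_Bseq) (auto simp: convergent_def)
  have real: "?\<phi> n = complex_of_real (Re (?\<phi> n))" for n by (simp add: prime_square_symbol_def)
  have "has_matrix (diag_ell2 d) (hankel_matrix ?\<phi>)"
  proof (rule has_matrix_diag_ell2[OF B])
    fix i j
    show "hankel_matrix ?\<phi> i j = (if i = j then complex_of_real (d i) else 0)"
    proof (cases "i = j")
      case True
      have "cnj (?\<phi> ((i + 2) * (i + 2))) = complex_of_real (Re (?\<phi> ((i + 2) * (i + 2))))"
        by (subst real) (simp only: complex_cnj_complex_of_real)
      then show ?thesis using True by (simp only: hankel_matrix_def d_def if_True refl)
    next
      case False
      then show ?thesis using prime_square_symbol_mult[of "i + 2" "j + 2" a]
        by (simp add: hankel_matrix_def)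
    qed
  qed
  moreover have "singular_value_sequence (diag_ell2 d) a"
    by (rule singular_value_sequence_diag_ell2[OF B dec pos inj on off])
  ultimately show ?thesis
    unfolding hankel_in_schatten_def using compact_operator_diag_ell2[OF lim_d] lp by blast
qed

lemma prime_square_symbol_L2_symbol_summable:
  assumes \<psi>: "\<psi> \<in> L2_torus" and eq: "hankel_eq_on_H2_0 (prime_square_symbol a) \<psi>"
  shows "summable (\<lambda>k. (a k)\<^sup>2)"
proof (rule summableI_nonneg_bounded)
  have coeff: "(LINT z|torus_measure. z k ^ 2 * cnj (\<psi> z)) = complex_of_real (a k)" for k
  proof -
    \<comment> \<open>Testing both forms on the pair \<open>(f, f)\<close> with \<open>f\<close> the
      single term at the prime \<open>q\<close> isolates one coefficient: the Hankel form gives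
      \<open>a k\<close>, and the square of the lift is \<open>(z k)\<^sup>2\<close>.\<close>
    define q where "q = nth_prime k"
    define f :: dirichlet_series where "f n = (if n = q then 1 else 0)" for n
    have q: "2 \<le> q" unfolding q_def by (rule two_le_nth_prime)
    have supp: "{n. f n \<noteq> 0} = {q}" by (auto simp: f_def)
    have poly: "dirichlet_polynomial f" using q supp by (simp add: dirichlet_polynomial_def f_def)
    have "summable (\<lambda>n. (cmod (f n))\<^sup>2)"
      by (rule summable_finite[of "{q}"]) (auto simp: f_def)
    then have "f \<in> H2_0" using q by (simp add: H2_0_def H2_def f_def)
    then have "hankel_form (prime_square_symbol a) f f = torus_hankel_form \<psi> f f"
      using eq poly by (simp add: hankel_eq_on_H2_0_def)
    moreover have "hankel_form (prime_square_symbol a) f f = complex_of_real (a k)"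
      unfolding hankel_form_eq_sum[OF poly poly] supp
      using prime_square_symbol_prime_square[of a k] by (simp add: f_def q_def power2_eq_square)
    moreover have "bohr_lift f z = z k" for z
    proof -
      have "bohr_lift f z = (\<Sum>n\<in>{q}. f n * torus_monomial n z)"
        unfolding bohr_lift_def by (rule suminf_finite) (auto simp: f_def)
      then show ?thesis by (simp add: f_def q_def torus_monomial_nth_prime)
    qed
    ultimately show ?thesis by (simp add: torus_hankel_form_def power2_eq_square)
  qed
  show "(\<Sum>k<n. (a k)\<^sup>2) \<le> (LINT z|torus_measure. (cmod (\<psi> z))\<^sup>2)" for n
    using torus_square_coefficients_bessel[OF \<psi>, of "{..<n}"] by (simp add: coeff)
qed simp

section \<open>Coefficients at the critical exponent\<close>

theorem theorem6:
  fixes p :: ennreal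
  assumes "2 < p"
  shows "(\<exists>\<phi>. hankel_in_schatten p \<phi> \<and> \<not> (\<exists>\<psi>\<in>L2_torus. hankel_eq_on_H2_0 \<phi> \<psi>)) \<and>
         (\<exists>\<phi>. hankel_in_schatten p \<phi> \<and> \<not> (\<exists>\<psi>. bounded_symbol \<phi> \<psi>))"
proof -
  \<comment> \<open>The exponent is critical: the \<open>p\<close>-th powers are
    \<open>(k + 1)\<close> to the power \<open>- p / 2\<close>, summable for \<open>p > 2\<close>,
    while the squares form the harmonic series.\<close>
  define a :: "nat \<Rightarrow> real" where "a k = real (Suc k) powr (- 1 / 2)" for k
  have dec: "a n < a m" if "m < n" for m n
    unfolding a_def using that by (intro powr_less_mono2_neg) auto
  have pos: "0 < a k" for k by (simp add: a_def)
  have lim: "a \<longlonglongrightarrow> 0"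
    unfolding a_def
    by (intro LIMSEQ_Suc[where f="\<lambda>k. real k powr (- 1 / 2)"] tendsto_neg_powr
        filterlim_real_sequentially) simp
  have lp: "a \<in> little_lp p"
  proof (cases "p = \<infinity>")
    \<comment> \<open>At \<open>p = \<infinity>\<close> membership in \<open>little_lp\<close> means
      boundedness, which follows from convergence.\<close>
    case True
    have "Bseq a" using lim by (intro convergent_imp_Bseq) (auto simp: convergent_def)
    then show ?thesis using True by (simp add: little_lp_def)
  next
    case False
    then have "2 < enn2real p"
      using assms by (cases p) (auto simp: ennreal_less_iff ennreal_numeral[symmetric] simp del: ennreal_numeral)
    then have "summable (\<lambda>k. real (Suc k) powr (- enn2real p / 2))"
      by (subst summable_Suc_iff) (simp add: summable_real_powr_iff)
    then show ?thesis using False by (simp add: little_lp_def a_def powr_powr mult.commute)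
  qed
  have S: "hankel_in_schatten p (prime_square_symbol a)"
    by (rule hankel_in_schatten_prime_square_symbol[OF dec pos lim lp])
  have "(\<lambda>k. (a k)\<^sup>2) = (\<lambda>k. inverse (real (Suc k)))"
    unfolding a_def power2_eq_square powr_add[symmetric] by (simp add: powr_minus)
  then have "\<not> summable (\<lambda>k. (a k)\<^sup>2)"
    using not_summable_harmonic[where 'a=real] summable_Suc_iff[of "\<lambda>n. inverse (real n)"] by simp
  then have no: "\<not> (\<exists>\<psi>\<in>L2_torus. hankel_eq_on_H2_0 (prime_square_symbol a) \<psi>)"
    using prime_square_symbol_L2_symbol_summable by blast
  \<comment> \<open>The same symbol witnesses both existence claims.\<close>
  then have "\<not> (\<exists>\<psi>. bounded_symbol (prime_square_symbol a) \<psi>)"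
    using Linf_torus_subset_L2_torus by (auto simp: bounded_symbol_def)
  then show ?thesis using S no by blast
qed

end
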